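(* Let $(X,d_X)$ be a metric space. Then the semigroup $M(X)$ of equivalence classes of metrics on the double of $X$, with multiplication given by composition of metrics, is an inverse semigroup; that is, for every $a\in M(X)$ there exists a unique $b\in M(X)$ such that $a=aba$ and $b=bab$.
   Context: Let $(X,d_X)$ be a metric space. Write $x$ for $(x,0)$ and $x'$ for $(x,1)$ in $X\times\{0,1\}$, identify $X$ with $X\times\{0\}$ and put $X'=X\times\{1\}$. $\mathcal M(X)$ is the set of all metrics $d$ on $X\times\{0,1\}$ (metrics on the double of $X$) whose restriction to each of the two copies of $X$ equals $d_X$ and for which the distance between the copies is non-zero: $\inf_{x,y\in X}d(x,y')>0$. Such $d$ is determined by the values $d(x,y')$, $x,y\in X$. Equivalence: $d_1\sim d_2$ if there exist $\alpha>0$, $\beta\ge 1$ with $-\alpha+\frac1\beta d_1(x,y')\le d_2(x,y')\le\alpha+\beta d_1(x,y')$ for all $x,y\in X$. $[d]$ is the class of $d$ and $M(X)=\mathcal M(X)/\sim$. Composition: for $\rho,d\in\mathcal M(X)$, $\rho d=\rho\circ d\in\mathcal M(X)$ is given by $\rho d(x,z')=\inf_{y\in X}[d(x,y')+\rho(y,z')]$. It is associative and respects $\sim$, so $M(X)$ is a semigroup with $[\rho][d]=[\rho d]$. *)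

theory Defs
  imports "HOL-Analysis.Analysis"
begin

text \<open>
  The double of \<open>X\<close> is \<open>X \<times> UNIV\<close> with second component in \<open>bool\<close>: \<open>(x, False)\<close> is the point
  \<open>x\<close> of the first copy, \<open>(x, True)\<close> is the point \<open>x'\<close> of the second copy.  Values of a metric
  outside this carrier are junk, as everywhere with \<^locale>\<open>Metric_space\<close>; the equivalence
  relation below ignores them, so they do not affect the quotient.
\<close>

text \<open>
  The infimum is taken in \<^typ>\<open>ereal\<close>, so that it is \<open>\<infinity>\<close> for empty \<open>X\<close>; for nonempty \<open>X\<close> it is
  the real infimum.
\<close>

definition double_metrics ::
    "'a set \<Rightarrow> ('a \<Rightarrow> 'a \<Rightarrow> real) \<Rightarrow> ('a \<times> bool \<Rightarrow> 'a \<times> bool \<Rightarrow> real) set" where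
  "double_metrics X dX =
     {d. Metric_space (X \<times> UNIV) d \<and>
         (\<forall>i. \<forall>x\<in>X. \<forall>y\<in>X. d (x, i) (y, i) = dX x y) \<and>
         (INF (x, y)\<in>X \<times> X. ereal (d (x, False) (y, True))) > 0}"

definition double_rel ::
    "'a set \<Rightarrow> ('a \<Rightarrow> 'a \<Rightarrow> real) \<Rightarrow>
     (('a \<times> bool \<Rightarrow> 'a \<times> bool \<Rightarrow> real) \<times> ('a \<times> bool \<Rightarrow> 'a \<times> bool \<Rightarrow> real)) set" where
  "double_rel X dX =
     {(d\<^sub>1, d\<^sub>2). d\<^sub>1 \<in> double_metrics X dX \<and> d\<^sub>2 \<in> double_metrics X dX \<and>
        (\<exists>\<alpha> \<beta>. \<alpha> > 0 \<and> \<beta> \<ge> 1 \<and>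
          (\<forall>x\<in>X. \<forall>y\<in>X.
             - \<alpha> + 1 / \<beta> * d\<^sub>1 (x, False) (y, True) \<le> d\<^sub>2 (x, False) (y, True) \<and>
             d\<^sub>2 (x, False) (y, True) \<le> \<alpha> + \<beta> * d\<^sub>1 (x, False) (y, True)))}"

definition cross_dist ::
    "'a set \<Rightarrow> ('a \<times> bool \<Rightarrow> 'a \<times> bool \<Rightarrow> real) \<Rightarrow> ('a \<times> bool \<Rightarrow> 'a \<times> bool \<Rightarrow> real) \<Rightarrow>
     'a \<Rightarrow> 'a \<Rightarrow> real" where
  "cross_dist X \<rho> d x z = (INF y\<in>X. d (x, False) (y, True) + \<rho> (y, False) (z, True))"

text \<open>
  The metric on the double that restricts to \<open>dX\<close> on both copies and has \<^const>\<open>cross_dist\<close> as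
  distance between the copies; \<open>0\<close> outside the carrier makes it nonnegative and symmetric
  everywhere, as \<^locale>\<open>Metric_space\<close> requires.
\<close>

definition metric_comp ::
    "'a set \<Rightarrow> ('a \<Rightarrow> 'a \<Rightarrow> real) \<Rightarrow>
     ('a \<times> bool \<Rightarrow> 'a \<times> bool \<Rightarrow> real) \<Rightarrow> ('a \<times> bool \<Rightarrow> 'a \<times> bool \<Rightarrow> real) \<Rightarrow>
     'a \<times> bool \<Rightarrow> 'a \<times> bool \<Rightarrow> real" where
  "metric_comp X dX \<rho> d = (\<lambda>(x, i) (z, j).
     if x \<in> X \<and> z \<in> X then
       (if i = j then dX x z
        else if j then cross_dist X \<rho> d x z
        else cross_dist X \<rho> d z x)
     else 0)"

definition double_classes ::
    "'a set \<Rightarrow> ('a \<Rightarrow> 'a \<Rightarrow> real) \<Rightarrow> ('a \<times> bool \<Rightarrow> 'a \<times> bool \<Rightarrow> real) set set" where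
  "double_classes X dX = double_metrics X dX // double_rel X dX"

definition class_mult ::
    "'a set \<Rightarrow> ('a \<Rightarrow> 'a \<Rightarrow> real) \<Rightarrow>
     ('a \<times> bool \<Rightarrow> 'a \<times> bool \<Rightarrow> real) set \<Rightarrow> ('a \<times> bool \<Rightarrow> 'a \<times> bool \<Rightarrow> real) set \<Rightarrow>
     ('a \<times> bool \<Rightarrow> 'a \<times> bool \<Rightarrow> real) set" where
  "class_mult X dX a b = (\<Union>\<rho>\<in>a. \<Union>d\<in>b. double_rel X dX `` {metric_comp X dX \<rho> d})"

definition inverse_semigroup_on :: "'b set \<Rightarrow> ('b \<Rightarrow> 'b \<Rightarrow> 'b) \<Rightarrow> bool" where
  "inverse_semigroup_on S m \<longleftrightarrow>
     (\<forall>a\<in>S. \<forall>b\<in>S. m a b \<in> S) \<and>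
     (\<forall>a\<in>S. \<forall>b\<in>S. \<forall>c\<in>S. m (m a b) c = m a (m b c)) \<and>
     (\<forall>a\<in>S. \<exists>!b. b \<in> S \<and> a = m (m a b) a \<and> b = m (m b a) b)"

lemma double_metricsD:
  assumes "d \<in> double_metrics X dX"
  shows "Metric_space (X \<times> UNIV) d"
    and "\<And>i x y. x \<in> X \<Longrightarrow> y \<in> X \<Longrightarrow> d (x, i) (y, i) = dX x y"
    and "\<exists>c>0. \<forall>x\<in>X. \<forall>y\<in>X. c \<le> d (x, False) (y, True)"
proof -
  show "Metric_space (X \<times> UNIV) d"
    and "\<And>i x y. x \<in> X \<Longrightarrow> y \<in> X \<Longrightarrow> d (x, i) (y, i) = dX x y"
    using assms by (auto simp: double_metrics_def)
  let ?I = "INF (x, y)\<in>X \<times> X. ereal (d (x, False) (y, True))"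
  have "0 < ?I" using assms by (simp add: double_metrics_def)
  then obtain c where c: "0 < ereal c" "ereal c < ?I"
    using ereal_dense2 by blast
  have "c \<le> d (x, False) (y, True)" if "x \<in> X" "y \<in> X" for x y
  proof -
    have "?I \<le> ereal (d (x, False) (y, True))"
      by (rule INF_lower2[of "(x, y)"]) (use that in auto)
    with c(2) show ?thesis by (simp add: less_le_trans flip: ereal_less_eq(3))
  qed
  with c(1) show "\<exists>c>0. \<forall>x\<in>X. \<forall>y\<in>X. c \<le> d (x, False) (y, True)" by auto
qed

lemma double_metricsI:
  assumes "Metric_space (X \<times> UNIV) d"
    and "\<And>i x y. x \<in> X \<Longrightarrow> y \<in> X \<Longrightarrow> d (x, i) (y, i) = dX x y"
    and "c > 0" and "\<And>x y. x \<in> X \<Longrightarrow> y \<in> X \<Longrightarrow> c \<le> d (x, False) (y, True)"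
  shows "d \<in> double_metrics X dX"
proof -
  have "ereal c \<le> (INF (x, y)\<in>X \<times> X. ereal (d (x, False) (y, True)))"
    by (rule INF_greatest) (use assms(4) in auto)
  moreover have "0 < ereal c" using assms(3) by simp
  ultimately have "0 < (INF (x, y)\<in>X \<times> X. ereal (d (x, False) (y, True)))"
    by (rule less_le_trans[rotated])
  then show ?thesis using assms by (auto simp: double_metrics_def)
qed

lemma equiv_double_rel: "equiv (double_metrics X dX) (double_rel X dX)"
proof (rule equivI)
  show "double_rel X dX \<subseteq> double_metrics X dX \<times> double_metrics X dX"
    by (auto simp: double_rel_def)
  show "refl_on (double_metrics X dX) (double_rel X dX)"
    by (rule refl_onI) (auto simp: double_rel_def intro!: exI[of _ "1::real"])
  show "sym (double_rel X dX)"
  proof (rule symI)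
    fix d e assume "(d, e) \<in> double_rel X dX"
    then obtain \<alpha> \<beta> where h: "d \<in> double_metrics X dX" "e \<in> double_metrics X dX"
        "\<alpha> > 0" "\<beta> \<ge> 1"
      and b: "\<And>x y. x \<in> X \<Longrightarrow> y \<in> X \<Longrightarrow>
         - \<alpha> + 1 / \<beta> * d (x, False) (y, True) \<le> e (x, False) (y, True) \<and>
         e (x, False) (y, True) \<le> \<alpha> + \<beta> * d (x, False) (y, True)"
      unfolding double_rel_def by auto
    have pos: "\<alpha> * \<beta> > 0" "\<alpha> \<le> \<alpha> * \<beta>" "\<alpha> / \<beta> \<le> \<alpha> * \<beta>"
      using h(3,4) by (auto simp: divide_simps mult_ge1_I intro: order.trans[OF _ mult_left_mono])
    have "- (\<alpha> * \<beta>) + 1 / \<beta> * e (x, False) (y, True) \<le> d (x, False) (y, True) \<and>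
          d (x, False) (y, True) \<le> \<alpha> * \<beta> + \<beta> * e (x, False) (y, True)"
      if "x \<in> X" "y \<in> X" for x y
    proof -
      let ?d = "d (x, False) (y, True)" and ?e = "e (x, False) (y, True)"
      have "?e / \<beta> \<le> \<alpha> / \<beta> + ?d"
        using b[OF that] h(4) by (simp add: field_simps)
      moreover have "?d \<le> \<alpha> * \<beta> + \<beta> * ?e"
        using b[OF that] h(4) by (simp add: field_simps)
      ultimately show ?thesis using pos(3) by simp
    qed
    with h pos(1) show "(e, d) \<in> double_rel X dX"
      unfolding double_rel_def by blast
  qed
  show "trans (double_rel X dX)"
  proof (rule transI)
    fix d e f assume "(d, e) \<in> double_rel X dX" "(e, f) \<in> double_rel X dX"
    then obtain \<alpha> \<beta> \<gamma> \<delta> where h: "d \<in> double_metrics X dX" "f \<in> double_metrics X dX"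
        "\<alpha> > 0" "\<beta> \<ge> 1" "\<gamma> > 0" "\<delta> \<ge> 1"
      and b: "\<And>x y. x \<in> X \<Longrightarrow> y \<in> X \<Longrightarrow>
         - \<alpha> + 1 / \<beta> * d (x, False) (y, True) \<le> e (x, False) (y, True) \<and>
         e (x, False) (y, True) \<le> \<alpha> + \<beta> * d (x, False) (y, True)"
      and b': "\<And>x y. x \<in> X \<Longrightarrow> y \<in> X \<Longrightarrow>
         - \<gamma> + 1 / \<delta> * e (x, False) (y, True) \<le> f (x, False) (y, True) \<and>
         f (x, False) (y, True) \<le> \<gamma> + \<delta> * e (x, False) (y, True)"
      unfolding double_rel_def by auto
    have le: "\<alpha> / \<delta> \<le> \<delta> * \<alpha>"
    proof -
      have "\<alpha> / \<delta> \<le> \<alpha> / 1" by (rule divide_left_mono) (use h in auto)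
      also have "\<dots> \<le> \<delta> * \<alpha>" using h by simp
      finally show ?thesis .
    qed
    have bd: "\<beta> * \<delta> \<ge> 1" using h mult_mono[of 1 \<beta> 1 \<delta>] by simp
    have "- (\<gamma> + \<delta> * \<alpha>) + 1 / (\<beta> * \<delta>) * d (x, False) (y, True) \<le> f (x, False) (y, True) \<and>
          f (x, False) (y, True) \<le> (\<gamma> + \<delta> * \<alpha>) + (\<beta> * \<delta>) * d (x, False) (y, True)"
      if "x \<in> X" "y \<in> X" for x y
    proof -
      let ?d = "d (x, False) (y, True)" and ?e = "e (x, False) (y, True)"
      have "1 / \<delta> * (- \<alpha> + 1 / \<beta> * ?d) \<le> 1 / \<delta> * ?e"
        by (rule mult_left_mono) (use b[OF that] h in auto)
      then have "- (\<alpha> / \<delta>) + 1 / (\<beta> * \<delta>) * ?d \<le> 1 / \<delta> * ?e"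
        using h by (simp add: field_simps)
      moreover have "\<delta> * ?e \<le> \<delta> * (\<alpha> + \<beta> * ?d)"
        by (rule mult_left_mono) (use b[OF that] h in auto)
      then have "\<delta> * ?e \<le> \<delta> * \<alpha> + (\<beta> * \<delta>) * ?d" by (simp add: algebra_simps)
      ultimately show ?thesis using b'[OF that] le by linarith
    qed
    moreover have "\<gamma> + \<delta> * \<alpha> > 0" using h by (simp add: add_pos_pos)
    ultimately show "(d, f) \<in> double_rel X dX"
      using h bd unfolding double_rel_def by blast
  qed
qed

lemma cross_dist_le:
  assumes "\<rho> \<in> double_metrics X dX" "d \<in> double_metrics X dX" "y \<in> X"
  shows "cross_dist X \<rho> d x z \<le> d (x, False) (y, True) + \<rho> (y, False) (z, True)"
proof -
  interpret D: Metric_space "X \<times> UNIV" d using double_metricsD(1)[OF assms(2)] .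
  interpret R: Metric_space "X \<times> UNIV" \<rho> using double_metricsD(1)[OF assms(1)] .
  have "bdd_below ((\<lambda>y. d (x, False) (y, True) + \<rho> (y, False) (z, True)) ` X)"
    by (rule bdd_belowI2[of _ 0]) simp
  then show ?thesis unfolding cross_dist_def using assms(3) by (rule cINF_lower)
qed

lemma cross_dist_ge:
  assumes "X \<noteq> {}" "\<And>y. y \<in> X \<Longrightarrow> c \<le> d (x, False) (y, True) + \<rho> (y, False) (z, True)"
  shows "c \<le> cross_dist X \<rho> d x z"
  unfolding cross_dist_def using assms by (rule cINF_greatest)

lemma metric_comp_in:
  assumes M: "Metric_space X dX"
    and \<rho>: "\<rho> \<in> double_metrics X dX" and d: "d \<in> double_metrics X dX"
  shows "metric_comp X dX \<rho> d \<in> double_metrics X dX"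
proof -
  interpret X: Metric_space X dX by fact
  interpret D: Metric_space "X \<times> UNIV" d using double_metricsD(1)[OF d] .
  interpret R: Metric_space "X \<times> UNIV" \<rho> using double_metricsD(1)[OF \<rho>] .
  note dd = double_metricsD(2)[OF d] and rr = double_metricsD(2)[OF \<rho>]
  obtain c where c: "c > 0" "\<And>x y. x \<in> X \<Longrightarrow> y \<in> X \<Longrightarrow> c \<le> d (x, False) (y, True)"
    using double_metricsD(3)[OF d] by blast
  let ?C = "cross_dist X \<rho> d"
  note le = cross_dist_le[OF \<rho> d]
  have C_ge: "c \<le> ?C x z" if "x \<in> X" "z \<in> X" for x z
  proof (rule cross_dist_ge)
    show "X \<noteq> {}" using that by auto
    fix y assume "y \<in> X"
    then show "c \<le> d (x, False) (y, True) + \<rho> (y, False) (z, True)"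
      using c(2)[OF that(1)] R.nonneg by (meson add_increasing2)
  qed
  have l: "?C x z \<le> dX x w + ?C w z" if "x \<in> X" "w \<in> X" "z \<in> X" for x w z
  proof -
    have "?C x z - dX x w \<le> ?C w z"
    proof (rule cross_dist_ge)
      show "X \<noteq> {}" using that by auto
      fix y assume y: "y \<in> X"
      show "?C x z - dX x w \<le> d (w, False) (y, True) + \<rho> (y, False) (z, True)"
        using le[OF y, of x z] D.triangle[of "(x, False)" "(w, False)" "(y, True)"]
          dd[of x w False] y that by auto
    qed
    then show ?thesis by simp
  qed
  have r: "?C x z \<le> ?C x w + dX w z" if "x \<in> X" "w \<in> X" "z \<in> X" for x w z
  proof -
    have "?C x z - dX w z \<le> ?C x w"
    proof (rule cross_dist_ge)
      show "X \<noteq> {}" using that by auto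
      fix y assume y: "y \<in> X"
      show "?C x z - dX w z \<le> d (x, False) (y, True) + \<rho> (y, False) (w, True)"
        using le[OF y, of x z] R.triangle[of "(y, False)" "(w, True)" "(z, True)"]
          rr[of w z True] y that by auto
    qed
    then show ?thesis by simp
  qed
  have s: "dX x w \<le> ?C x z + ?C w z" if "x \<in> X" "w \<in> X" "z \<in> X" for x w z
  proof -
    have "dX x w - ?C w z \<le> ?C x z"
    proof (rule cross_dist_ge)
      show ne: "X \<noteq> {}" using that by auto
      fix y assume y: "y \<in> X"
      have "dX x w - (d (x, False) (y, True) + \<rho> (y, False) (z, True)) \<le> ?C w z"
      proof (rule cross_dist_ge[OF ne])
        fix v assume v: "v \<in> X"
        have "dX x w \<le> d (x, False) (v, True) + d (w, False) (v, True)"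
          using D.triangle[of "(x, False)" "(v, True)" "(w, False)"]
            D.commute[of "(v, True)" "(w, False)"] dd[of x w False] that v by auto
        moreover have "d (x, False) (v, True) \<le> d (x, False) (y, True) + dX y v"
          using D.triangle[of "(x, False)" "(y, True)" "(v, True)"]
            dd[of y v True] that v y by auto
        moreover have "dX y v \<le> \<rho> (y, False) (z, True) + \<rho> (v, False) (z, True)"
          using R.triangle[of "(y, False)" "(z, True)" "(v, False)"]
            R.commute[of "(z, True)" "(v, False)"] rr[of y v False] that v y by auto
        ultimately show "dX x w - (d (x, False) (y, True) + \<rho> (y, False) (z, True))
            \<le> d (w, False) (v, True) + \<rho> (v, False) (z, True)" by linarith
      qed
      then show "dX x w - ?C w z \<le> d (x, False) (y, True) + \<rho> (y, False) (z, True)" by linarith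
    qed
    then show ?thesis by simp
  qed
  have s': "dX x w \<le> ?C z x + ?C z w" if "x \<in> X" "w \<in> X" "z \<in> X" for x w z
  proof -
    have "dX x w - ?C z w \<le> ?C z x"
    proof (rule cross_dist_ge)
      show ne: "X \<noteq> {}" using that by auto
      fix y assume y: "y \<in> X"
      have "dX x w - (d (z, False) (y, True) + \<rho> (y, False) (x, True)) \<le> ?C z w"
      proof (rule cross_dist_ge[OF ne])
        fix v assume v: "v \<in> X"
        have "dX x w \<le> \<rho> (v, False) (x, True) + \<rho> (v, False) (w, True)"
          using R.triangle[of "(x, True)" "(v, False)" "(w, True)"]
            R.commute[of "(x, True)" "(v, False)"] rr[of x w True] that v by auto
        moreover have "\<rho> (v, False) (x, True) \<le> dX v y + \<rho> (y, False) (x, True)"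
          using R.triangle[of "(v, False)" "(y, False)" "(x, True)"]
            rr[of v y False] that v y by auto
        moreover have "dX v y \<le> d (z, False) (v, True) + d (z, False) (y, True)"
          using D.triangle[of "(v, True)" "(z, False)" "(y, True)"]
            D.commute[of "(v, True)" "(z, False)"] dd[of v y True] that v y by auto
        ultimately show "dX x w - (d (z, False) (y, True) + \<rho> (y, False) (x, True))
            \<le> d (z, False) (v, True) + \<rho> (v, False) (w, True)" by linarith
      qed
      then show "dX x w - ?C z w \<le> d (z, False) (y, True) + \<rho> (y, False) (x, True)" by linarith
    qed
    then show ?thesis by simp
  qed
  have C_pos: "0 < ?C x z" if "x \<in> X" "z \<in> X" for x z
    using C_ge[OF that] c(1) by linarith
  show ?thesis
  proof (rule double_metricsI[OF _ _ c(1)])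
    show "Metric_space (X \<times> UNIV) (metric_comp X dX \<rho> d)"
    proof
      fix p q
      show "0 \<le> metric_comp X dX \<rho> d p q"
        using C_pos by (auto simp: metric_comp_def less_imp_le split: prod.split)
      show "metric_comp X dX \<rho> d p q = metric_comp X dX \<rho> d q p"
        by (auto simp: metric_comp_def X.commute split: prod.split)
    next
      fix p q assume "p \<in> X \<times> (UNIV :: bool set)" "q \<in> X \<times> (UNIV :: bool set)"
      then show "metric_comp X dX \<rho> d p q = 0 \<longleftrightarrow> p = q"
        using C_pos by (force simp: metric_comp_def split: prod.split)
    next
      fix p q r' assume pqr: "p \<in> X \<times> (UNIV :: bool set)" "q \<in> X \<times> (UNIV :: bool set)"
        "r' \<in> X \<times> (UNIV :: bool set)"
      obtain x i y j z k where e: "p = (x, i)" "q = (y, j)" "r' = (z, k)"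
        by (cases p, cases q, cases r')
      have m: "x \<in> X" "y \<in> X" "z \<in> X" using pqr e by auto
      show "metric_comp X dX \<rho> d p r' \<le> metric_comp X dX \<rho> d p q + metric_comp X dX \<rho> d q r'"
        unfolding e metric_comp_def
        using m X.triangle[of x y z] l[of x y z] l[of z y x] r[of x y z] r[of z y x]
          s[of x z y] s'[of x z y] X.commute[of x y] X.commute[of y z]
        by (cases i; cases j; cases k) auto
    qed
  next
    fix i x y assume "x \<in> X" "y \<in> X"
    then show "metric_comp X dX \<rho> d (x, i) (y, i) = dX x y"
      by (simp add: metric_comp_def)
  next
    fix x y assume "x \<in> X" "y \<in> X"
    then show "c \<le> metric_comp X dX \<rho> d (x, False) (y, True)"
      using C_ge by (simp add: metric_comp_def)
  qed
qed

lemma cross_dist_upper: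
  assumes "\<rho>\<^sub>1 \<in> double_metrics X dX" "d\<^sub>1 \<in> double_metrics X dX"
    and "(\<rho>\<^sub>1, \<rho>\<^sub>2) \<in> double_rel X dX" "(d\<^sub>1, d\<^sub>2) \<in> double_rel X dX"
  shows "\<exists>\<alpha> \<beta>. \<alpha> > 0 \<and> \<beta> \<ge> 1 \<and>
     (\<forall>x\<in>X. \<forall>z\<in>X. cross_dist X \<rho>\<^sub>2 d\<^sub>2 x z \<le> \<alpha> + \<beta> * cross_dist X \<rho>\<^sub>1 d\<^sub>1 x z)"
proof -
  obtain \<alpha> \<beta> where h: "\<alpha> > 0" "\<beta> \<ge> 1" "d\<^sub>2 \<in> double_metrics X dX"
    and b: "\<And>x y. x \<in> X \<Longrightarrow> y \<in> X \<Longrightarrow>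
        d\<^sub>2 (x, False) (y, True) \<le> \<alpha> + \<beta> * d\<^sub>1 (x, False) (y, True)"
    using assms(4) unfolding double_rel_def by auto
  obtain \<gamma> \<delta> where h': "\<gamma> > 0" "\<delta> \<ge> 1" "\<rho>\<^sub>2 \<in> double_metrics X dX"
    and b': "\<And>x y. x \<in> X \<Longrightarrow> y \<in> X \<Longrightarrow>
        \<rho>\<^sub>2 (x, False) (y, True) \<le> \<gamma> + \<delta> * \<rho>\<^sub>1 (x, False) (y, True)"
    using assms(3) unfolding double_rel_def by auto
  interpret D: Metric_space "X \<times> UNIV" d\<^sub>1 using double_metricsD(1)[OF assms(2)] .
  interpret R: Metric_space "X \<times> UNIV" \<rho>\<^sub>1 using double_metricsD(1)[OF assms(1)] .
  define \<epsilon> where "\<epsilon> = max \<beta> \<delta>"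
  have \<epsilon>: "\<epsilon> \<ge> 1" "\<beta> \<le> \<epsilon>" "\<delta> \<le> \<epsilon>" using h by (auto simp: \<epsilon>_def)
  have "cross_dist X \<rho>\<^sub>2 d\<^sub>2 x z \<le> (\<alpha> + \<gamma>) + \<epsilon> * cross_dist X \<rho>\<^sub>1 d\<^sub>1 x z"
    if xz: "x \<in> X" "z \<in> X" for x z
  proof -
    have "(cross_dist X \<rho>\<^sub>2 d\<^sub>2 x z - (\<alpha> + \<gamma>)) / \<epsilon> \<le> cross_dist X \<rho>\<^sub>1 d\<^sub>1 x z"
    proof (rule cross_dist_ge)
      show "X \<noteq> {}" using xz by auto
      fix y assume y: "y \<in> X"
      let ?d = "d\<^sub>1 (x, False) (y, True)" and ?r = "\<rho>\<^sub>1 (y, False) (z, True)"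
      have "cross_dist X \<rho>\<^sub>2 d\<^sub>2 x z \<le> d\<^sub>2 (x, False) (y, True) + \<rho>\<^sub>2 (y, False) (z, True)"
        by (rule cross_dist_le[OF h'(3) h(3) y])
      moreover have "\<beta> * ?d \<le> \<epsilon> * ?d" "\<delta> * ?r \<le> \<epsilon> * ?r"
        using \<epsilon> by (auto intro: mult_right_mono)
      ultimately have "cross_dist X \<rho>\<^sub>2 d\<^sub>2 x z - (\<alpha> + \<gamma>) \<le> (?d + ?r) * \<epsilon>"
        using b[OF xz(1) y] b'[OF y xz(2)] by (simp add: algebra_simps)
      then show "(cross_dist X \<rho>\<^sub>2 d\<^sub>2 x z - (\<alpha> + \<gamma>)) / \<epsilon> \<le> ?d + ?r"
        using \<epsilon> by (simp add: divide_le_eq)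
    qed
    then show ?thesis using \<epsilon> by (simp add: divide_le_eq algebra_simps)
  qed
  moreover have "\<alpha> + \<gamma> > 0" using h h' by simp
  ultimately show ?thesis using \<epsilon>(1) by blast
qed

lemma metric_comp_rel:
  assumes M: "Metric_space X dX"
    and r: "(\<rho>\<^sub>1, \<rho>\<^sub>2) \<in> double_rel X dX" and d: "(d\<^sub>1, d\<^sub>2) \<in> double_rel X dX"
  shows "(metric_comp X dX \<rho>\<^sub>1 d\<^sub>1, metric_comp X dX \<rho>\<^sub>2 d\<^sub>2) \<in> double_rel X dX"
proof -
  have m: "\<rho>\<^sub>1 \<in> double_metrics X dX" "\<rho>\<^sub>2 \<in> double_metrics X dX"
      "d\<^sub>1 \<in> double_metrics X dX" "d\<^sub>2 \<in> double_metrics X dX"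
    using r d unfolding double_rel_def by auto
  have r': "(\<rho>\<^sub>2, \<rho>\<^sub>1) \<in> double_rel X dX" and d': "(d\<^sub>2, d\<^sub>1) \<in> double_rel X dX"
    using equiv_double_rel r d by (meson equivE symD)+
  obtain \<alpha> \<beta> where 1: "\<alpha> > 0" "\<beta> \<ge> 1" "\<And>x z. x \<in> X \<Longrightarrow> z \<in> X \<Longrightarrow>
      cross_dist X \<rho>\<^sub>2 d\<^sub>2 x z \<le> \<alpha> + \<beta> * cross_dist X \<rho>\<^sub>1 d\<^sub>1 x z"
    using cross_dist_upper[OF m(1,3) r d] by blast
  obtain \<gamma> \<delta> where 2: "\<gamma> > 0" "\<delta> \<ge> 1" "\<And>x z. x \<in> X \<Longrightarrow> z \<in> X \<Longrightarrow>
      cross_dist X \<rho>\<^sub>1 d\<^sub>1 x z \<le> \<gamma> + \<delta> * cross_dist X \<rho>\<^sub>2 d\<^sub>2 x z"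
    using cross_dist_upper[OF m(2,4) r' d'] by blast
  have in1: "metric_comp X dX \<rho>\<^sub>1 d\<^sub>1 \<in> double_metrics X dX"
    and in2: "metric_comp X dX \<rho>\<^sub>2 d\<^sub>2 \<in> double_metrics X dX"
    using metric_comp_in[OF M] m by auto
  define \<epsilon> where "\<epsilon> = max \<beta> \<delta>"
  have \<epsilon>: "\<epsilon> \<ge> 1" "\<beta> \<le> \<epsilon>" "\<delta> \<le> \<epsilon>" using 1 by (auto simp: \<epsilon>_def)
  have "- (\<alpha> + \<gamma>) + 1 / \<epsilon> * cross_dist X \<rho>\<^sub>1 d\<^sub>1 x z \<le> cross_dist X \<rho>\<^sub>2 d\<^sub>2 x z \<and>
        cross_dist X \<rho>\<^sub>2 d\<^sub>2 x z \<le> (\<alpha> + \<gamma>) + \<epsilon> * cross_dist X \<rho>\<^sub>1 d\<^sub>1 x z"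
    if xz: "x \<in> X" "z \<in> X" for x z
  proof -
    let ?a = "cross_dist X \<rho>\<^sub>1 d\<^sub>1 x z" and ?b = "cross_dist X \<rho>\<^sub>2 d\<^sub>2 x z"
    have eq: "?a = metric_comp X dX \<rho>\<^sub>1 d\<^sub>1 (x, False) (z, True)"
      "?b = metric_comp X dX \<rho>\<^sub>2 d\<^sub>2 (x, False) (z, True)"
      using xz by (auto simp: metric_comp_def)
    have nn: "0 \<le> ?a" "0 \<le> ?b"
      unfolding eq using Metric_space.nonneg[OF double_metricsD(1)] in1 in2 by blast+
    have "\<beta> * ?a \<le> \<epsilon> * ?a" "\<delta> * ?b \<le> \<epsilon> * ?b" using nn \<epsilon> by (auto intro: mult_right_mono)
    moreover have "\<gamma> \<le> \<epsilon> * \<gamma>" "0 \<le> \<epsilon> * \<alpha>" using \<epsilon> 1 2 by auto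
    ultimately have "?a \<le> \<epsilon> * ((\<alpha> + \<gamma>) + ?b)" "?b \<le> (\<alpha> + \<gamma>) + \<epsilon> * ?a"
      unfolding distrib_left using 1(3)[OF xz] 2(3)[OF xz] 2(1) by linarith+
    moreover from this(1) have "?a / \<epsilon> \<le> (\<alpha> + \<gamma>) + ?b"
      using \<epsilon> by (simp add: divide_le_eq mult.commute)
    ultimately show ?thesis by simp
  qed
  then have "- (\<alpha> + \<gamma>) + 1 / \<epsilon> * metric_comp X dX \<rho>\<^sub>1 d\<^sub>1 (x, False) (z, True)
          \<le> metric_comp X dX \<rho>\<^sub>2 d\<^sub>2 (x, False) (z, True) \<and>
        metric_comp X dX \<rho>\<^sub>2 d\<^sub>2 (x, False) (z, True)
          \<le> (\<alpha> + \<gamma>) + \<epsilon> * metric_comp X dX \<rho>\<^sub>1 d\<^sub>1 (x, False) (z, True)"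
    if "x \<in> X" "z \<in> X" for x z
    using that by (simp add: metric_comp_def)
  moreover have "\<alpha> + \<gamma> > 0" using 1 2 by simp
  ultimately show ?thesis
    using in1 in2 \<epsilon>(1) unfolding double_rel_def by blast
qed

theorem class_mult_class:
  assumes M: "Metric_space X dX"
    and "\<rho> \<in> double_metrics X dX" "d \<in> double_metrics X dX"
  shows "class_mult X dX (double_rel X dX `` {\<rho>}) (double_rel X dX `` {d}) =
         double_rel X dX `` {metric_comp X dX \<rho> d}"
proof -
  have "congruent2 (double_rel X dX) (double_rel X dX)
          (\<lambda>\<rho> d. double_rel X dX `` {metric_comp X dX \<rho> d})"
    by (rule congruent2I') (meson M equiv_class_eq equiv_double_rel metric_comp_rel)
  from UN_equiv_class2[OF equiv_double_rel equiv_double_rel this] assms(2,3)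
  show ?thesis by (simp add: class_mult_def)
qed

end

theory Submission
  imports Defs
begin

text \<open>
  Because the two copies of \<open>X\<close> are a positive distance apart, the additive constant in the
  equivalence can be absorbed: equivalence is bi-Lipschitz equivalence of the functions
  \<open>d(x, y')\<close>.  Exchanging the copies turns \<open>d\<close> into an adjoint \<open>d*\<close>; the triangle inequality along
  \<open>x, y', z, w'\<close> gives \<open>d \<le> d d* d\<close>, and the path \<open>x, w', x, w'\<close> gives \<open>d d* d \<le> 3 d\<close>, so the
  semigroup is regular.  If \<open>e\<close> is idempotent, then \<open>e(x, x')\<close> and \<open>e(z, z')\<close> are both at most a
  multiple of \<open>e(x, z')\<close>; hence, for idempotents \<open>e\<close> and \<open>f\<close>, any path from \<open>x\<close> to \<open>z'\<close> for \<open>e f\<close>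
  through \<open>y\<close> is comparable to the path for \<open>f e\<close> through the same \<open>y\<close>.  So idempotents commute,
  and a regular semigroup with commuting idempotents is inverse.
\<close>

section \<open>Regular semigroups with commuting idempotents\<close>

text \<open>Uniqueness holds because any two inverses \<open>b\<close> and \<open>c\<close> of
  \<open>a\<close> both equal the product \<open>b a c\<close>: the products \<open>a b\<close>,
  \<open>a c\<close>, \<open>b a\<close>, \<open>c a\<close> are idempotent and hence commute where
  required.\<close>

lemma inverse_semigroup_onI:
  assumes closed: "\<And>a b. a \<in> S \<Longrightarrow> b \<in> S \<Longrightarrow> m a b \<in> S"
    and assoc: "\<And>a b c. a \<in> S \<Longrightarrow> b \<in> S \<Longrightarrow> c \<in> S \<Longrightarrow> m (m a b) c = m a (m b c)"
    and regular: "\<And>a. a \<in> S \<Longrightarrow> \<exists>b\<in>S. a = m (m a b) a \<and> b = m (m b a) b"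
    and commute: "\<And>e f. e \<in> S \<Longrightarrow> f \<in> S \<Longrightarrow> m e e = e \<Longrightarrow> m f f = f \<Longrightarrow> m e f = m f e"
  shows "inverse_semigroup_on S m"
proof -
  have unique: "b = c"
    if S: "a \<in> S" "b \<in> S" "c \<in> S"
      and b: "a = m (m a b) a" "b = m (m b a) b"
      and c: "a = m (m a c) a" "c = m (m c a) c" for a b c
  proof -
    note cl = closed S
    \<comment> \<open>Bracketing to the left exposes \<open>a b a\<close>, \<open>a c a\<close>,
      \<open>b a b\<close> and \<open>c a c\<close> as subterms, which then collapse.\<close>
    have idem: "m (m a b) (m a b) = m a b" "m (m a c) (m a c) = m a c"
      "m (m b a) (m b a) = m b a" "m (m c a) (m c a) = m c a"
      by (simp_all add: assoc[symmetric] cl flip: b c)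
    \<comment> \<open>The middle \<open>a\<close> of \<open>b a b\<close> is expanded to
      \<open>a c a\<close>; exchanging \<open>a c\<close> with \<open>a b\<close> then leaves
      \<open>b a b\<close> in front.\<close>
    have "b = m (m b (m (m a c) a)) b"
      unfolding c(1)[symmetric] by (rule b(2))
    also have "\<dots> = m b (m (m a c) (m a b))"
      by (simp add: assoc cl)
    also have "\<dots> = m b (m (m a b) (m a c))"
      using commute[of "m a c" "m a b"] idem cl by simp
    also have "\<dots> = m (m (m b a) b) (m a c)"
      by (simp add: assoc cl)
    finally have b_eq: "b = m b (m a c)"
      unfolding b(2)[symmetric] .
    \<comment> \<open>The mirror image: \<open>a\<close> becomes \<open>a b a\<close>, and
      exchanging \<open>c a\<close> with \<open>b a\<close> leaves \<open>c a c\<close> at the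
      end.\<close>
    have "c = m (m c (m (m a b) a)) c"
      unfolding b(1)[symmetric] by (rule c(2))
    also have "\<dots> = m (m (m c a) (m b a)) c"
      by (simp add: assoc cl)
    also have "\<dots> = m (m (m b a) (m c a)) c"
      using commute[of "m c a" "m b a"] idem cl by simp
    also have "\<dots> = m (m b a) (m (m c a) c)"
      by (simp add: assoc cl)
    also have "\<dots> = m b (m a c)"
      unfolding c(2)[symmetric] by (simp add: assoc cl)
    finally have "c = m b (m a c)" .
    with b_eq show ?thesis by metis
  qed
  show ?thesis
    unfolding inverse_semigroup_on_def
  proof (intro conjI ballI ex_ex1I)
    fix a assume "a \<in> S"
    then show "\<exists>b. b \<in> S \<and> a = m (m a b) a \<and> b = m (m b a) b"
      using regular by metis
  next
    fix a b c
    assume "a \<in> S" "b \<in> S \<and> a = m (m a b) a \<and> b = m (m b a) b"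
      "c \<in> S \<and> a = m (m a c) a \<and> c = m (m c a) c"
    then show "b = c"
      by (elim conjE) (rule unique)
  qed (fact closed assoc)+
qed

section \<open>Triangles in the double and the bi-Lipschitz form of the equivalence\<close>

lemma double_metric_nonneg:
  "d \<in> double_metrics X dX \<Longrightarrow> 0 \<le> d p q"
  by (meson Metric_space.nonneg double_metricsD(1))

lemma double_metric_commute:
  "d \<in> double_metrics X dX \<Longrightarrow> d p q = d q p"
  by (meson Metric_space.commute double_metricsD(1))

text \<open>These are the triangles with vertices in both copies, written with \<open>dX\<close> and
  the values \<open>d(x, y')\<close> alone, since only these enter compositions and the
  equivalence.\<close>

lemma double_metric_triangles:
  assumes d: "d \<in> double_metrics X dX" and X: "x \<in> X" "y \<in> X" "z \<in> X"
  shows "d (x, False) (z, True) \<le> dX x y + d (y, False) (z, True)"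
    and "d (x, False) (z, True) \<le> d (x, False) (y, True) + dX y z"
    and "dX x y \<le> d (x, False) (z, True) + d (y, False) (z, True)"
    and "dX x y \<le> d (z, False) (x, True) + d (z, False) (y, True)"
proof -
  interpret Metric_space "X \<times> UNIV" d by (rule double_metricsD(1)[OF d])
  note dd = double_metricsD(2)[OF d]
  show "d (x, False) (z, True) \<le> dX x y + d (y, False) (z, True)"
    using triangle[of "(x, False)" "(y, False)" "(z, True)"] dd[of x y False] X by simp
  show "d (x, False) (z, True) \<le> d (x, False) (y, True) + dX y z"
    using triangle[of "(x, False)" "(y, True)" "(z, True)"] dd[of y z True] X by simp
  show "dX x y \<le> d (x, False) (z, True) + d (y, False) (z, True)"
    using triangle[of "(x, False)" "(z, True)" "(y, False)"] dd[of x y False] X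
      commute[of "(z, True)" "(y, False)"] by simp
  show "dX x y \<le> d (z, False) (x, True) + d (z, False) (y, True)"
    using triangle[of "(x, True)" "(z, False)" "(y, True)"] dd[of x y True] X
      commute[of "(x, True)" "(z, False)"] by simp
qed

lemma double_rel_upper:
  assumes "(d, e) \<in> double_rel X dX"
  obtains K where "K > 0"
    "\<And>x y. x \<in> X \<Longrightarrow> y \<in> X \<Longrightarrow> e (x, False) (y, True) \<le> K * d (x, False) (y, True)"
proof -
  obtain \<alpha> \<beta> where \<alpha>\<beta>: "\<alpha> > 0" "\<beta> \<ge> 1" and d: "d \<in> double_metrics X dX"
    and le: "\<And>x y. x \<in> X \<Longrightarrow> y \<in> X \<Longrightarrow>
      e (x, False) (y, True) \<le> \<alpha> + \<beta> * d (x, False) (y, True)"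
    using assms unfolding double_rel_def by auto
  obtain c where c: "c > 0" "\<And>x y. x \<in> X \<Longrightarrow> y \<in> X \<Longrightarrow> c \<le> d (x, False) (y, True)"
    using double_metricsD(3)[OF d] by blast
  show ?thesis
  proof (rule that)
    show "\<alpha> / c + \<beta> > 0" using \<alpha>\<beta> c by (simp add: add_pos_pos)
    fix x y assume X: "x \<in> X" "y \<in> X"
    \<comment> \<open>The lower bound \<open>c\<close> on the distance between the copies turns the
      additive constant into a multiple of \<open>d\<close>.\<close>
    have "\<alpha> = \<alpha> / c * c" using c by simp
    also have "\<dots> \<le> \<alpha> / c * d (x, False) (y, True)"
      using c X \<alpha>\<beta> by (intro mult_left_mono) auto
    finally show "e (x, False) (y, True) \<le> (\<alpha> / c + \<beta>) * d (x, False) (y, True)"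
      using le[OF X] by (simp add: distrib_right)
  qed
qed

lemma double_relI:
  assumes d: "d \<in> double_metrics X dX" and e: "e \<in> double_metrics X dX"
    and de: "\<And>x y. x \<in> X \<Longrightarrow> y \<in> X \<Longrightarrow> d (x, False) (y, True) \<le> K * e (x, False) (y, True)"
    and ed: "\<And>x y. x \<in> X \<Longrightarrow> y \<in> X \<Longrightarrow> e (x, False) (y, True) \<le> L * d (x, False) (y, True)"
  shows "(d, e) \<in> double_rel X dX"
proof -
  \<comment> \<open>\<open>K\<close> and \<open>L\<close> may be any reals; the maximum with 1
    supplies \<beta> \<ge> 1, and nonnegativity of \<open>d\<close> and \<open>e\<close> lets both
    bounds survive the enlargement.\<close>
  define \<beta> where "\<beta> = max 1 (max K L)"
  have \<beta>: "\<beta> \<ge> 1" "K \<le> \<beta>" "L \<le> \<beta>" by (auto simp: \<beta>_def)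
  have "- 1 + 1 / \<beta> * d (x, False) (y, True) \<le> e (x, False) (y, True) \<and>
        e (x, False) (y, True) \<le> 1 + \<beta> * d (x, False) (y, True)"
    if X: "x \<in> X" "y \<in> X" for x y
  proof -
    let ?d = "d (x, False) (y, True)" and ?e = "e (x, False) (y, True)"
    have "K * ?e \<le> \<beta> * ?e" "L * ?d \<le> \<beta> * ?d"
      using \<beta> double_metric_nonneg[OF d] double_metric_nonneg[OF e]
      by (auto intro: mult_right_mono)
    then have "?d \<le> \<beta> * ?e" "?e \<le> \<beta> * ?d"
      using de[OF X] ed[OF X] by linarith+
    moreover from this(1) have "1 / \<beta> * ?d \<le> ?e"
      using \<beta> by (simp add: divide_le_eq mult.commute)
    ultimately show ?thesis by linarith
  qed
  then show ?thesis
    unfolding double_rel_def using d e \<beta>(1) zero_less_one by blast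
qed

section \<open>Composition as an infimum, and its associativity\<close>

lemma metric_comp_le:
  assumes "\<rho> \<in> double_metrics X dX" "d \<in> double_metrics X dX" "x \<in> X" "y \<in> X" "z \<in> X"
  shows "metric_comp X dX \<rho> d (x, False) (z, True)
    \<le> d (x, False) (y, True) + \<rho> (y, False) (z, True)"
  using assms cross_dist_le[of \<rho> X dX d y x z] by (simp add: metric_comp_def)

lemma metric_comp_ge:
  assumes "x \<in> X" "z \<in> X"
    and "\<And>y. y \<in> X \<Longrightarrow> c \<le> d (x, False) (y, True) + \<rho> (y, False) (z, True)"
  shows "c \<le> metric_comp X dX \<rho> d (x, False) (z, True)"
  using assms cross_dist_ge[of X c d x \<rho> z] by (auto simp: metric_comp_def)

text \<open>Both sides are the infimum of \<open>d(x, y') + \<sigma>(y, z') + \<rho>(z, w')\<close>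
  over all \<open>y\<close> and \<open>z\<close>.\<close>

lemma metric_comp_assoc:
  assumes M: "Metric_space X dX"
    and \<rho>: "\<rho> \<in> double_metrics X dX" and \<sigma>: "\<sigma> \<in> double_metrics X dX"
    and d: "d \<in> double_metrics X dX"
  shows "metric_comp X dX (metric_comp X dX \<rho> \<sigma>) d = metric_comp X dX \<rho> (metric_comp X dX \<sigma> d)"
    (is "?l = ?r")
proof -
  note in_comp = metric_comp_in[OF M \<rho> \<sigma>] metric_comp_in[OF M \<sigma> d]
  have eq: "?l (x, False) (w, True) = ?r (x, False) (w, True)" if X: "x \<in> X" "w \<in> X" for x w
  proof (rule antisym)
    show "?l (x, False) (w, True) \<le> ?r (x, False) (w, True)"
    proof (rule metric_comp_ge[OF X])
      fix z assume z: "z \<in> X"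
      \<comment> \<open>The leg that does not depend on the inner variable moves to the left, so
        that the inner infimum can be bounded below by itself.\<close>
      have "?l (x, False) (w, True) - \<rho> (z, False) (w, True)
        \<le> metric_comp X dX \<sigma> d (x, False) (z, True)"
      proof (rule metric_comp_ge[OF X(1) z])
        fix y assume y: "y \<in> X"
        show "?l (x, False) (w, True) - \<rho> (z, False) (w, True)
          \<le> d (x, False) (y, True) + \<sigma> (y, False) (z, True)"
          using metric_comp_le[OF in_comp(1) d X(1) y X(2)] metric_comp_le[OF \<rho> \<sigma> y z X(2)]
          by linarith
      qed
      then show "?l (x, False) (w, True)
        \<le> metric_comp X dX \<sigma> d (x, False) (z, True) + \<rho> (z, False) (w, True)"
        by linarith
    qed
    show "?r (x, False) (w, True) \<le> ?l (x, False) (w, True)"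
    proof (rule metric_comp_ge[OF X])
      fix y assume y: "y \<in> X"
      have "?r (x, False) (w, True) - d (x, False) (y, True)
        \<le> metric_comp X dX \<rho> \<sigma> (y, False) (w, True)"
      proof (rule metric_comp_ge[OF y X(2)])
        fix z assume z: "z \<in> X"
        show "?r (x, False) (w, True) - d (x, False) (y, True)
          \<le> \<sigma> (y, False) (z, True) + \<rho> (z, False) (w, True)"
          using metric_comp_le[OF \<rho> in_comp(2) X(1) z X(2)] metric_comp_le[OF \<sigma> d X(1) y z]
          by linarith
      qed
      then show "?r (x, False) (w, True)
        \<le> d (x, False) (y, True) + metric_comp X dX \<rho> \<sigma> (y, False) (w, True)"
        by linarith
    qed
  qed
  then have "cross_dist X (metric_comp X dX \<rho> \<sigma>) d x w = cross_dist X \<rho> (metric_comp X dX \<sigma> d) x w"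
    if "x \<in> X" "w \<in> X" for x w
    using that by (simp add: metric_comp_def)
  \<comment> \<open>Equality of functions follows because both sides are \<open>dX\<close> within a
    copy and 0 off the carrier; only the outer compositions are unfolded.\<close>
  then show ?thesis
    unfolding metric_comp_def[of X dX "metric_comp X dX \<rho> \<sigma>" d]
      metric_comp_def[of X dX \<rho> "metric_comp X dX \<sigma> d"]
    by (auto simp: fun_eq_iff)
qed

section \<open>The adjoint and regularity\<close>

definition adjoint :: "('a \<times> bool \<Rightarrow> 'a \<times> bool \<Rightarrow> real) \<Rightarrow> 'a \<times> bool \<Rightarrow> 'a \<times> bool \<Rightarrow> real" where
  "adjoint d = (\<lambda>(x, i) (y, j). d (x, \<not> i) (y, \<not> j))"

lemma adjoint_adjoint [simp]: "adjoint (adjoint d) = d"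
  by (simp add: adjoint_def fun_eq_iff)

lemma adjoint_cross:
  "d \<in> double_metrics X dX \<Longrightarrow> adjoint d (x, False) (y, True) = d (y, False) (x, True)"
  using double_metric_commute[of d X dX "(x, True)" "(y, False)"] by (simp add: adjoint_def)

lemma adjoint_in:
  assumes d: "d \<in> double_metrics X dX"
  shows "adjoint d \<in> double_metrics X dX"
proof -
  interpret Metric_space "X \<times> UNIV" d by (rule double_metricsD(1)[OF d])
  obtain c where c: "c > 0" "\<And>x y. x \<in> X \<Longrightarrow> y \<in> X \<Longrightarrow> c \<le> d (x, False) (y, True)"
    using double_metricsD(3)[OF d] by blast
  show ?thesis
  proof (rule double_metricsI[OF _ _ c(1)])
    show "Metric_space (X \<times> UNIV) (adjoint d)"
      by unfold_locales (auto simp: adjoint_def commute intro!: triangle)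
    show "\<And>i x y. x \<in> X \<Longrightarrow> y \<in> X \<Longrightarrow> adjoint d (x, i) (y, i) = dX x y"
      using double_metricsD(2)[OF d] by (simp add: adjoint_def)
    show "\<And>x y. x \<in> X \<Longrightarrow> y \<in> X \<Longrightarrow> c \<le> adjoint d (x, False) (y, True)"
      using c(2) by (simp add: adjoint_cross[OF d])
  qed
qed

lemma adjoint_regular:
  assumes M: "Metric_space X dX" and d: "d \<in> double_metrics X dX"
  shows "(d, metric_comp X dX (metric_comp X dX d (adjoint d)) d) \<in> double_rel X dX"
proof (rule double_relI[OF d])
  note ad = adjoint_in[OF d]
  note in_comp = metric_comp_in[OF M d ad]
  let ?e = "metric_comp X dX (metric_comp X dX d (adjoint d)) d"
  show "?e \<in> double_metrics X dX"
    by (rule metric_comp_in[OF M in_comp d])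
  fix x w assume X: "x \<in> X" "w \<in> X"
  show "d (x, False) (w, True) \<le> 1 * ?e (x, False) (w, True)"
    unfolding mult_1
  proof (rule metric_comp_ge[OF X])
    fix y assume y: "y \<in> X"
    have "d (x, False) (w, True) - d (x, False) (y, True)
      \<le> metric_comp X dX d (adjoint d) (y, False) (w, True)"
    proof (rule metric_comp_ge[OF y X(2)])
      fix z assume z: "z \<in> X"
      \<comment> \<open>The distance from \<open>x\<close> to \<open>z\<close> inside
        \<open>X\<close> is at most \<open>d(x, y') + d(z, y')\<close>, and the last term is the
        adjoint leg from \<open>y\<close> to \<open>z'\<close>.\<close>
      show "d (x, False) (w, True) - d (x, False) (y, True)
        \<le> adjoint d (y, False) (z, True) + d (z, False) (w, True)"
        using double_metric_triangles(1)[OF d X(1) z X(2)]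
          double_metric_triangles(3)[OF d X(1) z y] adjoint_cross[OF d, of y z]
        by linarith
    qed
    then show "d (x, False) (w, True)
      \<le> d (x, False) (y, True) + metric_comp X dX d (adjoint d) (y, False) (w, True)"
      by linarith
  qed
  \<comment> \<open>With intermediate points \<open>w\<close> and \<open>x\<close>, each of the
    three legs has length \<open>d(x, w')\<close>.\<close>
  show "?e (x, False) (w, True) \<le> 3 * d (x, False) (w, True)"
    using metric_comp_le[OF in_comp d X(1,2,2)] metric_comp_le[OF d ad X(2,1,2)]
      adjoint_cross[OF d, of w x]
    by linarith
qed

section \<open>Idempotents up to equivalence\<close>

text \<open>For every \<open>y\<close>, going from \<open>x\<close> to \<open>y'\<close> and then by
  \<open>dX\<close> to \<open>x'\<close> costs at most
  \<open>e(x, y') + e(y, z') + e(x, z')\<close>. The infimum over \<open>y\<close> bounds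
  \<open>e(x, x')\<close> by the square of \<open>e\<close> plus \<open>e\<close> at
  \<open>(x, z')\<close>, hence the factor \<open>K + 1\<close>. The bound at \<open>z\<close> is
  symmetric.\<close>

lemma idempotent_diagonal:
  assumes e: "e \<in> double_metrics X dX"
    and idem: "(e, metric_comp X dX e e) \<in> double_rel X dX"
  obtains K where "K > 0"
    "\<And>x z. x \<in> X \<Longrightarrow> z \<in> X \<Longrightarrow> e (x, False) (x, True) \<le> K * e (x, False) (z, True)"
    "\<And>x z. x \<in> X \<Longrightarrow> z \<in> X \<Longrightarrow> e (z, False) (z, True) \<le> K * e (x, False) (z, True)"
proof -
  obtain K where K: "K > 0" "\<And>x y. x \<in> X \<Longrightarrow> y \<in> X \<Longrightarrow>
      metric_comp X dX e e (x, False) (y, True) \<le> K * e (x, False) (y, True)"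
    using double_rel_upper[OF idem] by blast
  note tri = double_metric_triangles[OF e]
  show ?thesis
  proof (rule that)
    show "K + 1 > 0" using K by simp
    fix x z assume X: "x \<in> X" "z \<in> X"
    have "e (x, False) (x, True) - e (x, False) (z, True)
      \<le> metric_comp X dX e e (x, False) (z, True)"
    proof (rule metric_comp_ge[OF X])
      fix y assume y: "y \<in> X"
      show "e (x, False) (x, True) - e (x, False) (z, True)
        \<le> e (x, False) (y, True) + e (y, False) (z, True)"
        using tri(2)[of x y x] tri(3)[of y x z] X y by simp
    qed
    then show "e (x, False) (x, True) \<le> (K + 1) * e (x, False) (z, True)"
      using K(2)[OF X] by (simp add: distrib_right)
    have "e (z, False) (z, True) - e (x, False) (z, True)
      \<le> metric_comp X dX e e (x, False) (z, True)"
    proof (rule metric_comp_ge[OF X])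
      fix y assume y: "y \<in> X"
      show "e (z, False) (z, True) - e (x, False) (z, True)
        \<le> e (x, False) (y, True) + e (y, False) (z, True)"
        using tri(1)[of z y z] tri(4)[of z y x] X y by simp
    qed
    then show "e (z, False) (z, True) \<le> (K + 1) * e (x, False) (z, True)"
      using K(2)[OF X] by (simp add: distrib_right)
  qed
qed

lemma idempotents_commute_upper:
  assumes e: "e \<in> double_metrics X dX" and f: "f \<in> double_metrics X dX"
    and idem_e: "(e, metric_comp X dX e e) \<in> double_rel X dX"
    and idem_f: "(f, metric_comp X dX f f) \<in> double_rel X dX"
  shows "\<exists>K. \<forall>x\<in>X. \<forall>z\<in>X. metric_comp X dX f e (x, False) (z, True)
    \<le> K * metric_comp X dX e f (x, False) (z, True)"
proof -
  obtain K where K: "K > 0"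
    "\<And>x z. x \<in> X \<Longrightarrow> z \<in> X \<Longrightarrow> e (x, False) (x, True) \<le> K * e (x, False) (z, True)"
    "\<And>x z. x \<in> X \<Longrightarrow> z \<in> X \<Longrightarrow> e (z, False) (z, True) \<le> K * e (x, False) (z, True)"
    using idempotent_diagonal[OF e idem_e] by blast
  obtain L where L: "L > 0"
    "\<And>x z. x \<in> X \<Longrightarrow> z \<in> X \<Longrightarrow> f (x, False) (x, True) \<le> L * f (x, False) (z, True)"
    "\<And>x z. x \<in> X \<Longrightarrow> z \<in> X \<Longrightarrow> f (z, False) (z, True) \<le> L * f (x, False) (z, True)"
    using idempotent_diagonal[OF f idem_f] by blast
  \<comment> \<open>\<open>C\<close> dominates both \<open>2 * K + 1\<close> and
    \<open>2 * L + 1\<close>, the factors found below for the two legs.\<close>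
  define C where "C = 2 * K + 2 * L + 1"
  have C: "C > 0" using K L by (simp add: C_def)
  have "metric_comp X dX f e (x, False) (z, True)
      \<le> C * metric_comp X dX e f (x, False) (z, True)"
    if X: "x \<in> X" "z \<in> X" for x z
  proof -
    have "metric_comp X dX f e (x, False) (z, True) / C
        \<le> metric_comp X dX e f (x, False) (z, True)"
    proof (rule metric_comp_ge[OF X])
      fix y assume y: "y \<in> X"
      let ?e = "e (y, False) (z, True)" and ?f = "f (x, False) (y, True)"
      \<comment> \<open>Distances inside \<open>X\<close> are measured through \<open>y'\<close> by
        \<open>f\<close> and from \<open>y\<close> by \<open>e\<close>; the diagonal values at
        \<open>y\<close> are controlled by the legs \<open>?f\<close> and \<open>?e\<close>.\<close>
      have xy: "dX x y \<le> ?f + L * ?f"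
        using double_metric_triangles(3)[OF f X(1) y y] L(3)[OF X(1) y] by linarith
      have yz: "dX y z \<le> K * ?e + ?e"
        using double_metric_triangles(4)[OF e y X(2) y] K(2)[OF y X(2)] by linarith
      have "e (x, False) (y, True) \<le> dX x y + K * ?e"
        using double_metric_triangles(1)[OF e X(1) y y] K(2)[OF y X(2)] by linarith
      moreover have "f (y, False) (z, True) \<le> L * ?f + dX y z"
        using double_metric_triangles(2)[OF f y y X(2)] L(3)[OF X(1) y] by linarith
      ultimately have "metric_comp X dX f e (x, False) (z, True)
          \<le> (2 * K + 1) * ?e + (2 * L + 1) * ?f"
        using metric_comp_le[OF f e X(1) y X(2)] xy yz by (simp add: distrib_right)
      also have "\<dots> \<le> C * ?e + C * ?f"
        using K(1) L(1) double_metric_nonneg[OF e] double_metric_nonneg[OF f]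
        unfolding C_def by (intro add_mono mult_right_mono) auto
      finally show "metric_comp X dX f e (x, False) (z, True) / C \<le> ?f + ?e"
        using C by (simp add: divide_le_eq algebra_simps)
    qed
    then show ?thesis using C by (simp add: divide_le_eq mult.commute)
  qed
  then show ?thesis by blast
qed

lemma idempotents_commute:
  assumes M: "Metric_space X dX"
    and e: "e \<in> double_metrics X dX" and f: "f \<in> double_metrics X dX"
    and idem_e: "(e, metric_comp X dX e e) \<in> double_rel X dX"
    and idem_f: "(f, metric_comp X dX f f) \<in> double_rel X dX"
  shows "(metric_comp X dX e f, metric_comp X dX f e) \<in> double_rel X dX"
  using idempotents_commute_upper[OF e f idem_e idem_f]
    idempotents_commute_upper[OF f e idem_f idem_e]
    double_relI[OF metric_comp_in[OF M e f] metric_comp_in[OF M f e]]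
  by meson

section \<open>Passage to equivalence classes\<close>

theorem theorem5p3:
  fixes X :: "'a set" and dX :: "'a \<Rightarrow> 'a \<Rightarrow> real"
  assumes "Metric_space X dX"
  shows "inverse_semigroup_on (double_classes X dX) (class_mult X dX)"
proof -
  let ?M = "double_metrics X dX"
  define cls where "cls d = double_rel X dX `` {d}" for d
  note in_comp = metric_comp_in[OF assms]
  have cls_eq: "cls d = cls e \<longleftrightarrow> (d, e) \<in> double_rel X dX" if "d \<in> ?M" "e \<in> ?M" for d e
    unfolding cls_def using eq_equiv_class_iff[OF equiv_double_rel that] .
  have mult: "class_mult X dX (cls \<rho>) (cls d) = cls (metric_comp X dX \<rho> d)"
    if "\<rho> \<in> ?M" "d \<in> ?M" for \<rho> d
    unfolding cls_def using class_mult_class[OF assms that] .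
  have classes: "double_classes X dX = cls ` ?M"
    by (auto simp: double_classes_def quotient_def cls_def)
  show ?thesis
    unfolding classes
  proof (rule inverse_semigroup_onI)
    fix a assume "a \<in> cls ` ?M"
    then obtain d where d: "d \<in> ?M" "a = cls d" by blast
    have ad: "adjoint d \<in> ?M" by (rule adjoint_in[OF d(1)])
    have "a = class_mult X dX (class_mult X dX a (cls (adjoint d))) a"
      using adjoint_regular[OF assms d(1)] d ad by (simp add: mult in_comp cls_eq)
    \<comment> \<open>Regularity is applied to \<open>adjoint d\<close>, whose adjoint is
      \<open>d\<close> again by \<open>adjoint_adjoint\<close>.\<close>
    moreover have "cls (adjoint d) =
        class_mult X dX (class_mult X dX (cls (adjoint d)) a) (cls (adjoint d))"
      using adjoint_regular[OF assms ad] d ad by (simp add: mult in_comp cls_eq)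
    ultimately show "\<exists>b\<in>cls ` ?M. a = class_mult X dX (class_mult X dX a b) a \<and>
        b = class_mult X dX (class_mult X dX b a) b"
      using ad by blast
  next
    fix a b assume ab: "a \<in> cls ` ?M" "b \<in> cls ` ?M"
      and idem: "class_mult X dX a a = a" "class_mult X dX b b = b"
    obtain e f where ef: "e \<in> ?M" "a = cls e" "f \<in> ?M" "b = cls f"
      using ab by blast
    have "(e, metric_comp X dX e e) \<in> double_rel X dX"
      "(f, metric_comp X dX f f) \<in> double_rel X dX"
      using idem ef by (simp_all add: mult in_comp flip: cls_eq)
    then show "class_mult X dX a b = class_mult X dX b a"
      using idempotents_commute[OF assms] ef by (simp add: mult in_comp cls_eq)
  qed (auto simp: mult in_comp metric_comp_assoc[OF assms])
qed

end
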